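(* Let $\mathbf A=\langle A,\wedge,\vee,\cdot,{\sim},-,\neg,1\rangle$ be a representable (respectively, finitely representable) distributive quasi relation algebra and let $p$ be a positive symmetric idempotent of $\mathbf A$. Then the contraction $p\mathbf Ap=\langle pAp,\wedge,\vee,\cdot,{\sim},-,\neg,p\rangle$ is representable (respectively, finitely representable).
   Context: A quasi relation algebra (qRA) is an algebra $\mathbf A=\langle A,\wedge,\vee,\cdot,{\sim},-,\neg,1\rangle$ such that $\langle A,\wedge,\vee\rangle$ is a lattice, $\langle A,\cdot,1\rangle$ is a monoid, and for all $a,b,c$: $ab\leqslant c$ iff $a\leqslant -(b\cdot{\sim}c)$ iff $b\leqslant {\sim}(-c\cdot a)$; ${\sim}{-}a=a={-}{\sim}a$; $\neg\neg a=a$; $\neg(a\vee b)=\neg a\wedge\neg b$; $\neg(ab)=\neg a+\neg b$ where $a+b:={\sim}(-a\cdot-b)$. It is distributive (a DqRA) if its lattice reduct is distributive. An element $p$ is positive if $1\leqslant p$, symmetric if ${\sim}p=-p=\neg p$, idempotent if $pp=p$. For such $p$, $pAp:=\{pap\mid a\in A\}$ is closed under $\wedge,\vee,\cdot,{\sim},-,\neg$, and $p\mathbf Ap$ denotes $pAp$ with the restricted operations and $p$ as monoid identity (it is a DqRA). Relational notation: for an equivalence relation $E$ on a set $X$ and $R,S\subseteq X^2$, $R^{\smile}=\{(y,x)\mid (x,y)\in R\}$, $R^c=\{(x,y)\in E\mid (x,y)\notin R\}$, $R;S=\{(x,y)\mid \exists z\,((x,z)\in R,(z,y)\in S)\}$;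 a function $\gamma:X\to X$ is identified with its graph. Given a poset $(X,\leqslant)$, an equivalence relation $E$ on $X$ with ${\leqslant}\subseteq E$, an order automorphism $\alpha$ and a self-inverse dual order automorphism $\beta$ of $(X,\leqslant)$ with $\alpha,\beta\subseteq E$ and $\alpha;\beta;\alpha=\beta$, order $E$ by $(u,v)\preccurlyeq(x,y)$ iff $x\leqslant u$ and $v\leqslant y$, and let $\mathsf{Up}(E)$ be the set of up-sets of $(E,\preccurlyeq)$; $\mathbf{Dq}(E)=\langle \mathsf{Up}(E),\cap,\cup,;,{\sim},-,\neg,\leqslant\rangle$ with ${\sim}R=R^{c\smile};\alpha$, $-R=\alpha;R^{c\smile}$, $\neg R=\alpha;\beta;R^c;\beta$ is a DqRA. A DqRA is representable if it embeds (via an injective homomorphism) into some such $\mathbf{Dq}(E)$, and finitely representable if it embeds into some such $\mathbf{Dq}(E)$ with $X$ finite.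
   Formalization: In the definition of a quasi relation algebra, a+b is taken as ~(−b·−a) instead of the printed ~(−a·−b), since with the printed order the algebras Dq(E) need not satisfy ¬(ab)=¬a+¬b; every representable algebra in the printed sense is still covered. *)

theory Defs
  imports "HOL-Algebra.Group"
begin

record 'a qra = "'a monoid" +
  qmeet :: "'a \<Rightarrow> 'a \<Rightarrow> 'a"  (infixl \<open>\<curlywedge>\<index>\<close> 66)
  qjoin :: "'a \<Rightarrow> 'a \<Rightarrow> 'a"  (infixl \<open>\<curlyvee>\<index>\<close> 65)
  tilde :: "'a \<Rightarrow> 'a"
  dash :: "'a \<Rightarrow> 'a"
  qneg :: "'a \<Rightarrow> 'a"

definition qle :: "('a, 'm) qra_scheme \<Rightarrow> 'a \<Rightarrow> 'a \<Rightarrow> bool"  (infix \<open>\<preceq>\<index>\<close> 50)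
  where "a \<preceq>\<^bsub>A\<^esub> b \<longleftrightarrow> a \<curlywedge>\<^bsub>A\<^esub> b = a"

text \<open>
  The order of the two factors is the one for which $\neg(ab) = \neg a + \neg b$ holds in
  the relational algebras \<open>Dq\<close> below (see \<open>dqra_Dq\<close>); in these, the variant
  \<open>tilde A (dash A a \<otimes>\<^bsub>A\<^esub> dash A b)\<close> satisfies $\neg(ba) = \neg a + \neg b$ instead.
\<close>

definition qplus :: "('a, 'm) qra_scheme \<Rightarrow> 'a \<Rightarrow> 'a \<Rightarrow> 'a"
  where "qplus A a b = tilde A (dash A b \<otimes>\<^bsub>A\<^esub> dash A a)"

locale qra = monoid A for A (structure) +
  assumes meet_closed: "\<lbrakk>a \<in> carrier A; b \<in> carrier A\<rbrakk> \<Longrightarrow> a \<curlywedge> b \<in> carrier A"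
    and join_closed: "\<lbrakk>a \<in> carrier A; b \<in> carrier A\<rbrakk> \<Longrightarrow> a \<curlyvee> b \<in> carrier A"
    and tilde_closed: "a \<in> carrier A \<Longrightarrow> tilde A a \<in> carrier A"
    and dash_closed: "a \<in> carrier A \<Longrightarrow> dash A a \<in> carrier A"
    and neg_closed: "a \<in> carrier A \<Longrightarrow> qneg A a \<in> carrier A"
    and meet_comm: "\<lbrakk>a \<in> carrier A; b \<in> carrier A\<rbrakk> \<Longrightarrow> a \<curlywedge> b = b \<curlywedge> a"
    and join_comm: "\<lbrakk>a \<in> carrier A; b \<in> carrier A\<rbrakk> \<Longrightarrow> a \<curlyvee> b = b \<curlyvee> a"
    and meet_assoc: "\<lbrakk>a \<in> carrier A; b \<in> carrier A; c \<in> carrier A\<rbrakk>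
          \<Longrightarrow> (a \<curlywedge> b) \<curlywedge> c = a \<curlywedge> (b \<curlywedge> c)"
    and join_assoc: "\<lbrakk>a \<in> carrier A; b \<in> carrier A; c \<in> carrier A\<rbrakk>
          \<Longrightarrow> (a \<curlyvee> b) \<curlyvee> c = a \<curlyvee> (b \<curlyvee> c)"
    and meet_absorb: "\<lbrakk>a \<in> carrier A; b \<in> carrier A\<rbrakk> \<Longrightarrow> a \<curlywedge> (a \<curlyvee> b) = a"
    and join_absorb: "\<lbrakk>a \<in> carrier A; b \<in> carrier A\<rbrakk> \<Longrightarrow> a \<curlyvee> (a \<curlywedge> b) = a"
    and residuation_dash: "\<lbrakk>a \<in> carrier A; b \<in> carrier A; c \<in> carrier A\<rbrakk>
          \<Longrightarrow> a \<otimes> b \<preceq> c \<longleftrightarrow> a \<preceq> dash A (b \<otimes> tilde A c)"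
    and residuation_tilde: "\<lbrakk>a \<in> carrier A; b \<in> carrier A; c \<in> carrier A\<rbrakk>
          \<Longrightarrow> a \<otimes> b \<preceq> c \<longleftrightarrow> b \<preceq> tilde A (dash A c \<otimes> a)"
    and tilde_dash: "a \<in> carrier A \<Longrightarrow> tilde A (dash A a) = a"
    and dash_tilde: "a \<in> carrier A \<Longrightarrow> dash A (tilde A a) = a"
    and neg_neg: "a \<in> carrier A \<Longrightarrow> qneg A (qneg A a) = a"
    and neg_join: "\<lbrakk>a \<in> carrier A; b \<in> carrier A\<rbrakk>
          \<Longrightarrow> qneg A (a \<curlyvee> b) = qneg A a \<curlywedge> qneg A b"
    and neg_mult: "\<lbrakk>a \<in> carrier A; b \<in> carrier A\<rbrakk>
          \<Longrightarrow> qneg A (a \<otimes> b) = qplus A (qneg A a) (qneg A b)"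

locale dqra = qra A for A (structure) +
  assumes meet_join_distrib: "\<lbrakk>a \<in> carrier A; b \<in> carrier A; c \<in> carrier A\<rbrakk>
          \<Longrightarrow> a \<curlywedge> (b \<curlyvee> c) = (a \<curlywedge> b) \<curlyvee> (a \<curlywedge> c)"

definition positive_elem :: "('a, 'm) qra_scheme \<Rightarrow> 'a \<Rightarrow> bool"
  where "positive_elem A p \<longleftrightarrow> \<one>\<^bsub>A\<^esub> \<preceq>\<^bsub>A\<^esub> p"

definition symmetric_elem :: "('a, 'm) qra_scheme \<Rightarrow> 'a \<Rightarrow> bool"
  where "symmetric_elem A p \<longleftrightarrow> tilde A p = dash A p \<and> dash A p = qneg A p"

definition idempotent_elem :: "('a, 'm) qra_scheme \<Rightarrow> 'a \<Rightarrow> bool"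
  where "idempotent_elem A p \<longleftrightarrow> p \<otimes>\<^bsub>A\<^esub> p = p"

definition contraction :: "('a, 'm) qra_scheme \<Rightarrow> 'a \<Rightarrow> ('a, 'm) qra_scheme"
  where "contraction A p =
    A\<lparr>carrier := {p \<otimes>\<^bsub>A\<^esub> a \<otimes>\<^bsub>A\<^esub> p | a. a \<in> carrier A}, one := p\<rparr>"

definition qra_hom :: "('a, 'm) qra_scheme \<Rightarrow> ('b, 'n) qra_scheme \<Rightarrow> ('a \<Rightarrow> 'b) set"
  where "qra_hom A B = {h \<in> hom A B.
    h \<one>\<^bsub>A\<^esub> = \<one>\<^bsub>B\<^esub> \<and>
    (\<forall>a\<in>carrier A. \<forall>b\<in>carrier A. h (a \<curlywedge>\<^bsub>A\<^esub> b) = h a \<curlywedge>\<^bsub>B\<^esub> h b) \<and>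
    (\<forall>a\<in>carrier A. \<forall>b\<in>carrier A. h (a \<curlyvee>\<^bsub>A\<^esub> b) = h a \<curlyvee>\<^bsub>B\<^esub> h b) \<and>
    (\<forall>a\<in>carrier A. h (tilde A a) = tilde B (h a)) \<and>
    (\<forall>a\<in>carrier A. h (dash A a) = dash B (h a)) \<and>
    (\<forall>a\<in>carrier A. h (qneg A a) = qneg B (h a))}"

definition embeds :: "('a, 'm) qra_scheme \<Rightarrow> ('b, 'n) qra_scheme \<Rightarrow> bool"
  where "embeds A B \<longleftrightarrow> (\<exists>h\<in>qra_hom A B. inj_on h (carrier A))"

definition graph_on :: "'x set \<Rightarrow> ('x \<Rightarrow> 'x) \<Rightarrow> 'x rel"
  where "graph_on X \<gamma> = {(x, \<gamma> x) | x. x \<in> X}"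

definition order_automorphism :: "'x set \<Rightarrow> 'x rel \<Rightarrow> ('x \<Rightarrow> 'x) \<Rightarrow> bool"
  where "order_automorphism X leq \<gamma> \<longleftrightarrow> bij_betw \<gamma> X X \<and>
    (\<forall>x\<in>X. \<forall>y\<in>X. (x, y) \<in> leq \<longleftrightarrow> (\<gamma> x, \<gamma> y) \<in> leq)"

definition dual_order_automorphism :: "'x set \<Rightarrow> 'x rel \<Rightarrow> ('x \<Rightarrow> 'x) \<Rightarrow> bool"
  where "dual_order_automorphism X leq \<gamma> \<longleftrightarrow> bij_betw \<gamma> X X \<and>
    (\<forall>x\<in>X. \<forall>y\<in>X. (x, y) \<in> leq \<longleftrightarrow> (\<gamma> y, \<gamma> x) \<in> leq)"

locale dq_frame =
  fixes X :: "'x set" and leq E :: "'x rel" and \<alpha> \<beta> :: "'x \<Rightarrow> 'x"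
  assumes poset: "partial_order_on X leq"
    and equiv_E: "equiv X E"
    and le_E: "leq \<subseteq> E"
    and alpha: "order_automorphism X leq \<alpha>"
    and beta: "dual_order_automorphism X leq \<beta>"
    and beta_self_inverse: "x \<in> X \<Longrightarrow> \<beta> (\<beta> x) = x"
    and alpha_E: "graph_on X \<alpha> \<subseteq> E"
    and beta_E: "graph_on X \<beta> \<subseteq> E"
    and alpha_beta_alpha: "graph_on X \<alpha> O graph_on X \<beta> O graph_on X \<alpha> = graph_on X \<beta>"

definition UpE :: "'x rel \<Rightarrow> 'x rel \<Rightarrow> 'x rel set"
  where "UpE leq E = {R. R \<subseteq> E \<and>
    (\<forall>u v x y. (u, v) \<in> R \<and> (x, y) \<in> E \<and> (x, u) \<in> leq \<and> (v, y) \<in> leq \<longrightarrow> (x, y) \<in> R)}"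

definition Dq :: "'x set \<Rightarrow> 'x rel \<Rightarrow> 'x rel \<Rightarrow> ('x \<Rightarrow> 'x) \<Rightarrow> ('x \<Rightarrow> 'x) \<Rightarrow> 'x rel qra"
  where "Dq X leq E \<alpha> \<beta> =
    \<lparr>carrier = UpE leq E, mult = (O), one = leq, qmeet = (\<inter>), qjoin = (\<union>),
     tilde = (\<lambda>R. (E - R)\<inverse> O graph_on X \<alpha>),
     dash = (\<lambda>R. graph_on X \<alpha> O (E - R)\<inverse>),
     qneg = (\<lambda>R. graph_on X \<alpha> O graph_on X \<beta> O (E - R) O graph_on X \<beta>)\<rparr>"

text \<open>
  HOL cannot quantify existentially over types, so the type from which the points of the
  representing poset are drawn is a parameter of both notions. A statement holding for all
  \<open>'x\<close>, with the same \<open>'x\<close> before and after an implication, yields the implication between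
  the notions in which the set of points is arbitrary.
\<close>

definition representable :: "'x itself \<Rightarrow> ('a, 'm) qra_scheme \<Rightarrow> bool"
  where "representable (_ :: 'x itself) A \<longleftrightarrow> dqra A \<and>
    (\<exists>(X :: 'x set) leq E \<alpha> \<beta>. dq_frame X leq E \<alpha> \<beta> \<and> embeds A (Dq X leq E \<alpha> \<beta>))"

definition finitely_representable :: "'x itself \<Rightarrow> ('a, 'm) qra_scheme \<Rightarrow> bool"
  where "finitely_representable (_ :: 'x itself) A \<longleftrightarrow> dqra A \<and>
    (\<exists>(X :: 'x set) leq E \<alpha> \<beta>. finite X \<and> dq_frame X leq E \<alpha> \<beta> \<and> embeds A (Dq X leq E \<alpha> \<beta>))"

context dq_frame
begin

lemma E_X: "(x, y) \<in> E \<Longrightarrow> x \<in> X" "(x, y) \<in> E \<Longrightarrow> y \<in> X"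
  and E_refl: "x \<in> X \<Longrightarrow> (x, x) \<in> E"
  and E_sym: "(x, y) \<in> E \<Longrightarrow> (y, x) \<in> E"
  and E_trans: "(x, y) \<in> E \<Longrightarrow> (y, z) \<in> E \<Longrightarrow> (x, z) \<in> E"
  using equiv_E by (auto simp: equiv_def refl_on_def dest: symD transD)

lemma le_refl: "x \<in> X \<Longrightarrow> (x, x) \<in> leq"
  and le_trans: "(x, y) \<in> leq \<Longrightarrow> (y, z) \<in> leq \<Longrightarrow> (x, z) \<in> leq"
  using poset by (auto simp: partial_order_on_def preorder_on_def refl_on_def dest: transD)

lemma alpha_X: "x \<in> X \<Longrightarrow> \<alpha> x \<in> X"
  and alpha_le: "x \<in> X \<Longrightarrow> y \<in> X \<Longrightarrow> (\<alpha> x, \<alpha> y) \<in> leq \<longleftrightarrow> (x, y) \<in> leq"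
  and alpha_inj: "x \<in> X \<Longrightarrow> y \<in> X \<Longrightarrow> \<alpha> x = \<alpha> y \<longleftrightarrow> x = y"
  using alpha by (auto simp: order_automorphism_def bij_betw_def inj_on_def)

lemma alpha_surj: "y \<in> X \<Longrightarrow> \<exists>x\<in>X. y = \<alpha> x"
  using alpha by (auto simp: order_automorphism_def bij_betw_def)

lemma beta_X: "x \<in> X \<Longrightarrow> \<beta> x \<in> X"
  and beta_le: "x \<in> X \<Longrightarrow> y \<in> X \<Longrightarrow> (\<beta> x, \<beta> y) \<in> leq \<longleftrightarrow> (y, x) \<in> leq"
  using beta by (auto simp: dual_order_automorphism_def bij_betw_def)

lemma alpha_rel: "x \<in> X \<Longrightarrow> (x, \<alpha> x) \<in> E"
  and beta_rel: "x \<in> X \<Longrightarrow> (x, \<beta> x) \<in> E"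
  using alpha_E beta_E by (auto simp: graph_on_def)

lemma aba: assumes "x \<in> X" shows "\<alpha> (\<beta> (\<alpha> x)) = \<beta> x"
proof -
  have "(x, \<alpha> (\<beta> (\<alpha> x))) \<in> graph_on X \<alpha> O graph_on X \<beta> O graph_on X \<alpha>"
    using assms alpha_X beta_X unfolding graph_on_def by blast
  then show ?thesis unfolding alpha_beta_alpha by (simp add: graph_on_def)
qed

lemma E_alpha1: "x \<in> X \<Longrightarrow> (\<alpha> x, y) \<in> E \<longleftrightarrow> (x, y) \<in> E"
  and E_alpha2: "y \<in> X \<Longrightarrow> (x, \<alpha> y) \<in> E \<longleftrightarrow> (x, y) \<in> E"
  and E_beta1: "x \<in> X \<Longrightarrow> (\<beta> x, y) \<in> E \<longleftrightarrow> (x, y) \<in> E"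
  and E_beta2: "y \<in> X \<Longrightarrow> (x, \<beta> y) \<in> E \<longleftrightarrow> (x, y) \<in> E"
  using alpha_rel beta_rel E_sym E_trans by meson+

lemma tilde_iff: "z \<in> X \<Longrightarrow> (x, \<alpha> z) \<in> tilde (Dq X leq E \<alpha> \<beta>) R \<longleftrightarrow> (z, x) \<in> E \<and> (z, x) \<notin> R"
  by (auto simp: Dq_def graph_on_def alpha_inj E_X)

lemma dash_iff: "(x, y) \<in> dash (Dq X leq E \<alpha> \<beta>) R \<longleftrightarrow> x \<in> X \<and> (y, \<alpha> x) \<in> E \<and> (y, \<alpha> x) \<notin> R"
  by (auto simp: Dq_def graph_on_def)

lemma neg_iff: "(x, y) \<in> qneg (Dq X leq E \<alpha> \<beta>) R \<longleftrightarrow>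
    x \<in> X \<and> y \<in> X \<and> (x, y) \<in> E \<and> (\<beta> (\<alpha> x), \<beta> y) \<notin> R" (is "?l \<longleftrightarrow> ?r")
proof
  assume ?l
  then obtain v where "x \<in> X" "(\<beta> (\<alpha> x), v) \<in> E - R" "y = \<beta> v" "v \<in> X"
    by (auto simp: Dq_def graph_on_def)
  then show ?r by (auto simp: beta_self_inverse beta_X alpha_X E_alpha1 E_beta1 E_beta2)
next
  assume r: ?r
  then have "(\<beta> (\<alpha> x), \<beta> y) \<in> E - R" by (auto simp: beta_X alpha_X E_alpha1 E_beta1 E_beta2)
  moreover have "(\<beta> y, y) \<in> graph_on X \<beta>"
    using r beta_X beta_self_inverse by (force simp: graph_on_def)
  moreover have "(x, \<alpha> x) \<in> graph_on X \<alpha>" "(\<alpha> x, \<beta> (\<alpha> x)) \<in> graph_on X \<beta>"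
    using r alpha_X by (auto simp: graph_on_def)
  ultimately show ?l unfolding Dq_def qra.simps by (meson relcompI)
qed

lemma up: "R \<in> UpE leq E \<Longrightarrow> (u, v) \<in> R \<Longrightarrow> (x, u) \<in> leq \<Longrightarrow> (v, y) \<in> leq \<Longrightarrow> (x, y) \<in> R"
proof -
  assume a: "R \<in> UpE leq E" "(u, v) \<in> R" "(x, u) \<in> leq" "(v, y) \<in> leq"
  then have "(x, u) \<in> E" "(u, v) \<in> E" "(v, y) \<in> E" using le_E unfolding UpE_def by blast+
  then have "(x, y) \<in> E" by (meson E_trans)
  then show ?thesis using a unfolding UpE_def by blast
qed

lemma UpE_I: "R \<subseteq> E \<Longrightarrow> (\<And>u v x y. (u, v) \<in> R \<Longrightarrow> (x, u) \<in> leq \<Longrightarrow> (v, y) \<in> leq \<Longrightarrow> (x, y) \<in> R)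
    \<Longrightarrow> R \<in> UpE leq E"
  unfolding UpE_def by blast

lemma le_X: "(x, y) \<in> leq \<Longrightarrow> x \<in> X" "(x, y) \<in> leq \<Longrightarrow> y \<in> X"
  using le_E E_X by blast+

lemma rel_ext: "(\<And>x y. (x, y) \<in> R \<longleftrightarrow> (x, y) \<in> S) \<Longrightarrow> R = S"
  by auto

lemma rel_eqI: assumes "R \<subseteq> E" "S \<subseteq> E" "\<And>x z. z \<in> X \<Longrightarrow> (x, \<alpha> z) \<in> R \<longleftrightarrow> (x, \<alpha> z) \<in> S"
  shows "R = S"
proof (rule rel_ext)
  fix x y
  show "(x, y) \<in> R \<longleftrightarrow> (x, y) \<in> S"
  proof (cases "y \<in> X")
    case True
    then show ?thesis using alpha_surj assms(3) by blast
  next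
    case False
    then show ?thesis using assms(1,2) E_X(2) by blast
  qed
qed

lemma tilde_sub: "tilde (Dq X leq E \<alpha> \<beta>) R \<subseteq> E"
  by (auto simp: Dq_def graph_on_def E_alpha2 E_X intro: E_sym)

lemma tilde_Up: assumes "R \<in> UpE leq E" shows "tilde (Dq X leq E \<alpha> \<beta>) R \<in> UpE leq E"
proof (rule UpE_I[OF tilde_sub])
  fix u v x y assume a: "(u, v) \<in> tilde (Dq X leq E \<alpha> \<beta>) R" "(x, u) \<in> leq" "(v, y) \<in> leq"
  obtain v' y' where v: "v = \<alpha> v'" "v' \<in> X" "y = \<alpha> y'" "y' \<in> X"
    using a(3) le_X alpha_surj by blast
  then have "(v', u) \<in> E - R" "(v', y') \<in> leq" using a by (auto simp: tilde_iff alpha_le)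
  then have "(y', x) \<in> E - R"
    using a(2) up[OF assms, of y' x v' u] le_E by (metis DiffD1 DiffD2 DiffI E_sym E_trans subsetD)
  then show "(x, y) \<in> tilde (Dq X leq E \<alpha> \<beta>) R" using v by (simp add: tilde_iff)
qed

lemma dash_sub: "dash (Dq X leq E \<alpha> \<beta>) R \<subseteq> E"
  by (clarsimp simp: dash_iff E_alpha2) (rule E_sym)

lemma dash_Up: assumes "R \<in> UpE leq E" shows "dash (Dq X leq E \<alpha> \<beta>) R \<in> UpE leq E"
proof (rule UpE_I[OF dash_sub])
  fix u v x y assume a: "(u, v) \<in> dash (Dq X leq E \<alpha> \<beta>) R" "(x, u) \<in> leq" "(v, y) \<in> leq"
  then have m: "(v, \<alpha> u) \<in> E - R" "(\<alpha> x, \<alpha> u) \<in> leq" by (auto simp: dash_iff alpha_le le_X)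
  then have "(y, \<alpha> x) \<in> E - R"
    using a(3) up[OF assms, of y "\<alpha> x" v "\<alpha> u"] le_E by (metis DiffD1 DiffD2 DiffI E_sym E_trans subsetD)
  then show "(x, y) \<in> dash (Dq X leq E \<alpha> \<beta>) R" using a(2) le_X by (auto simp: dash_iff)
qed

lemma neg_Up: assumes "R \<in> UpE leq E" shows "qneg (Dq X leq E \<alpha> \<beta>) R \<in> UpE leq E"
proof (rule UpE_I)
  show "qneg (Dq X leq E \<alpha> \<beta>) R \<subseteq> E" by (auto simp: neg_iff)
  fix u v x y assume a: "(u, v) \<in> qneg (Dq X leq E \<alpha> \<beta>) R" "(x, u) \<in> leq" "(v, y) \<in> leq"
  then have X: "u \<in> X" "v \<in> X" "x \<in> X" "y \<in> X" using le_X by auto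
  have "(\<beta> (\<alpha> u), \<beta> (\<alpha> x)) \<in> leq" "(\<beta> y, \<beta> v) \<in> leq"
    using a X by (auto simp: beta_le alpha_le alpha_X)
  then have "(\<beta> (\<alpha> x), \<beta> y) \<notin> R"
    using up[OF assms, of "\<beta> (\<alpha> x)" "\<beta> y" "\<beta> (\<alpha> u)" "\<beta> v"] a(1) by (auto simp: neg_iff)
  moreover have "(x, y) \<in> E" using a le_E by (auto simp: neg_iff intro: E_trans)
  ultimately show "(x, y) \<in> qneg (Dq X leq E \<alpha> \<beta>) R" using X by (simp add: neg_iff)
qed

lemma Dq_simps [simp]:
  "carrier (Dq X leq E \<alpha> \<beta>) = UpE leq E"
  "R \<otimes>\<^bsub>Dq X leq E \<alpha> \<beta>\<^esub> S = R O S"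
  "\<one>\<^bsub>Dq X leq E \<alpha> \<beta>\<^esub> = leq"
  "R \<curlywedge>\<^bsub>Dq X leq E \<alpha> \<beta>\<^esub> S = R \<inter> S"
  "R \<curlyvee>\<^bsub>Dq X leq E \<alpha> \<beta>\<^esub> S = R \<union> S"
  "R \<preceq>\<^bsub>Dq X leq E \<alpha> \<beta>\<^esub> S \<longleftrightarrow> R \<subseteq> S"
  by (auto simp: Dq_def qle_def)

lemma Up_sub: "R \<in> UpE leq E \<Longrightarrow> (x, y) \<in> R \<Longrightarrow> (x, y) \<in> E"
  unfolding UpE_def by blast

lemma comp_Up: assumes "R \<in> UpE leq E" "S \<in> UpE leq E" shows "R O S \<in> UpE leq E"
proof (rule UpE_I)
  show "R O S \<subseteq> E" using assms Up_sub E_trans by blast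
  fix u v x y assume "(u, v) \<in> R O S" and leq: "(x, u) \<in> leq" "(v, y) \<in> leq"
  then obtain w where w: "(u, w) \<in> R" "(w, v) \<in> S" by blast
  then have "w \<in> X" using Up_sub[OF assms(1)] E_X by blast
  then show "(x, y) \<in> R O S"
    using up[OF assms(1) w(1) leq(1)] up[OF assms(2) w(2) _ leq(2)] le_refl by blast
qed

lemma residuation1:
  assumes "R \<in> UpE leq E" "S \<in> UpE leq E" "T \<in> UpE leq E"
  shows "R O S \<subseteq> T \<longleftrightarrow> R \<subseteq> dash (Dq X leq E \<alpha> \<beta>) (S O tilde (Dq X leq E \<alpha> \<beta>) T)"
proof
  assume l: "R O S \<subseteq> T"
  show "R \<subseteq> dash (Dq X leq E \<alpha> \<beta>) (S O tilde (Dq X leq E \<alpha> \<beta>) T)"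
  proof clarify
    fix x y assume xy: "(x, y) \<in> R"
    then have x: "(x, y) \<in> E" "x \<in> X" using Up_sub[OF assms(1)] E_X by blast+
    have "(y, \<alpha> x) \<notin> S O tilde (Dq X leq E \<alpha> \<beta>) T"
      using l xy x(2) by (auto simp: tilde_iff)
    then show "(x, y) \<in> dash (Dq X leq E \<alpha> \<beta>) (S O tilde (Dq X leq E \<alpha> \<beta>) T)"
      using x by (auto simp: dash_iff E_alpha2 intro: E_sym)
  qed
next
  assume r: "R \<subseteq> dash (Dq X leq E \<alpha> \<beta>) (S O tilde (Dq X leq E \<alpha> \<beta>) T)"
  show "R O S \<subseteq> T"
  proof clarify
    fix x y z assume a: "(x, y) \<in> R" "(y, z) \<in> S"
    then have "(x, y) \<in> dash (Dq X leq E \<alpha> \<beta>) (S O tilde (Dq X leq E \<alpha> \<beta>) T)" using r by blast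
    then have "x \<in> X" "(y, \<alpha> x) \<notin> S O tilde (Dq X leq E \<alpha> \<beta>) T" unfolding dash_iff by blast+
    then have "(z, \<alpha> x) \<notin> tilde (Dq X leq E \<alpha> \<beta>) T" using a by blast
    moreover have "(x, z) \<in> E" using a assms Up_sub E_trans by blast
    ultimately show "(x, z) \<in> T" using \<open>x \<in> X\<close> by (simp add: tilde_iff)
  qed
qed

lemma residuation2:
  assumes "R \<in> UpE leq E" "S \<in> UpE leq E" "T \<in> UpE leq E"
  shows "R O S \<subseteq> T \<longleftrightarrow> S \<subseteq> tilde (Dq X leq E \<alpha> \<beta>) (dash (Dq X leq E \<alpha> \<beta>) T O R)"
proof
  assume l: "R O S \<subseteq> T"
  show "S \<subseteq> tilde (Dq X leq E \<alpha> \<beta>) (dash (Dq X leq E \<alpha> \<beta>) T O R)"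
  proof clarify
    fix y z assume yz: "(y, z) \<in> S"
    then have E: "(y, z) \<in> E" "z \<in> X" using Up_sub[OF assms(2)] E_X by blast+
    obtain z' where z: "z = \<alpha> z'" "z' \<in> X" using E alpha_surj by blast
    have "(z', y) \<notin> dash (Dq X leq E \<alpha> \<beta>) T O R"
      using l yz z by (auto simp: dash_iff)
    then show "(y, z) \<in> tilde (Dq X leq E \<alpha> \<beta>) (dash (Dq X leq E \<alpha> \<beta>) T O R)"
      using E z by (auto simp: tilde_iff E_alpha2 intro: E_sym)
  qed
next
  assume r: "S \<subseteq> tilde (Dq X leq E \<alpha> \<beta>) (dash (Dq X leq E \<alpha> \<beta>) T O R)"
  show "R O S \<subseteq> T"
  proof clarify
    fix x y z assume a: "(x, y) \<in> R" "(y, z) \<in> S"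
    have E: "(x, z) \<in> E" using a assms Up_sub E_trans by blast
    obtain z' where z: "z = \<alpha> z'" "z' \<in> X" using E_X(2)[OF E] alpha_surj by blast
    have "(y, \<alpha> z') \<in> tilde (Dq X leq E \<alpha> \<beta>) (dash (Dq X leq E \<alpha> \<beta>) T O R)" using r a z by blast
    then have "(z', y) \<notin> dash (Dq X leq E \<alpha> \<beta>) T O R" using z by (simp add: tilde_iff)
    then have "(z', x) \<notin> dash (Dq X leq E \<alpha> \<beta>) T" using a by blast
    then show "(x, z) \<in> T" using z E by (auto simp: dash_iff)
  qed
qed

lemma tilde_dash_Dq:
  assumes "R \<in> UpE leq E" shows "tilde (Dq X leq E \<alpha> \<beta>) (dash (Dq X leq E \<alpha> \<beta>) R) = R"
proof -
  have "(x, \<alpha> z) \<in> tilde (Dq X leq E \<alpha> \<beta>) (dash (Dq X leq E \<alpha> \<beta>) R) \<longleftrightarrow> (x, \<alpha> z) \<in> R" if "z \<in> X" for x z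
    using that Up_sub[OF assms, of x "\<alpha> z"] E_sym[of x z] E_sym[of z x]
    by (auto simp: tilde_iff dash_iff E_alpha2)
  then show ?thesis using tilde_sub Up_sub[OF assms] by (intro rel_eqI) auto
qed

lemma dash_tilde_Dq:
  assumes "R \<in> UpE leq E" shows "dash (Dq X leq E \<alpha> \<beta>) (tilde (Dq X leq E \<alpha> \<beta>) R) = R"
proof (rule rel_ext)
  fix x y
  show "(x, y) \<in> dash (Dq X leq E \<alpha> \<beta>) (tilde (Dq X leq E \<alpha> \<beta>) R) \<longleftrightarrow> (x, y) \<in> R"
  proof (cases "x \<in> X")
    case True
    then show ?thesis
      using Up_sub[OF assms, of x y] E_sym[of x y] E_sym[of y x] by (auto simp: dash_iff tilde_iff E_alpha2)
  next
    case False
    then show ?thesis using Up_sub[OF assms, of x y] E_X(1)[of x y] by (auto simp: dash_iff)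
  qed
qed

lemma neg_neg_Dq:
  assumes "R \<in> UpE leq E" shows "qneg (Dq X leq E \<alpha> \<beta>) (qneg (Dq X leq E \<alpha> \<beta>) R) = R"
proof (rule rel_ext)
  fix x y
  show "(x, y) \<in> qneg (Dq X leq E \<alpha> \<beta>) (qneg (Dq X leq E \<alpha> \<beta>) R) \<longleftrightarrow> (x, y) \<in> R"
  proof (cases "(x, y) \<in> E")
    case True
    then show ?thesis using E_X[OF True]
      by (simp add: neg_iff alpha_X beta_X beta_self_inverse E_alpha1 E_beta1 E_beta2 aba)
  next
    case False
    then show ?thesis using Up_sub[OF assms, of x y] by (auto simp: neg_iff)
  qed
qed

lemma neg_comp_Dq:
  assumes "R \<in> UpE leq E" "S \<in> UpE leq E"
  shows "qneg (Dq X leq E \<alpha> \<beta>) (R O S) =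
    qplus (Dq X leq E \<alpha> \<beta>) (qneg (Dq X leq E \<alpha> \<beta>) R) (qneg (Dq X leq E \<alpha> \<beta>) S)"
proof -
  let ?D = "Dq X leq E \<alpha> \<beta>"
  have *: "(x, \<alpha> z) \<in> qneg ?D (R O S) \<longleftrightarrow> (x, \<alpha> z) \<in> qplus ?D (qneg ?D R) (qneg ?D S)"
    if z: "z \<in> X" for x z
  proof (cases "(x, z) \<in> E")
    case True
    then have x: "x \<in> X" using E_X by blast
    have dS: "(z, w) \<in> dash ?D (qneg ?D S) \<longleftrightarrow> w \<in> X \<and> (w, z) \<in> E \<and> (\<beta> (\<alpha> w), \<beta> (\<alpha> z)) \<in> S" for w
      using z E_X by (auto simp: dash_iff neg_iff E_alpha2 alpha_X)
    have dR: "(w, x) \<in> dash ?D (qneg ?D R) \<longleftrightarrow> w \<in> X \<and> (x, w) \<in> E \<and> (\<beta> (\<alpha> x), \<beta> (\<alpha> w)) \<in> R" for w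
      using x E_X by (auto simp: dash_iff neg_iff E_alpha2 alpha_X)
    have "(\<beta> (\<alpha> x), \<beta> (\<alpha> z)) \<in> R O S \<longleftrightarrow> (z, x) \<in> dash ?D (qneg ?D S) O dash ?D (qneg ?D R)"
    proof
      assume "(\<beta> (\<alpha> x), \<beta> (\<alpha> z)) \<in> R O S"
      then obtain v where v: "(\<beta> (\<alpha> x), v) \<in> R" "(v, \<beta> (\<alpha> z)) \<in> S" by blast
      then have E: "(\<beta> (\<alpha> x), v) \<in> E" "(v, \<beta> (\<alpha> z)) \<in> E" using assms Up_sub by blast+
      then have "v \<in> X" using E_X by blast
      then obtain w where w: "\<beta> v = \<alpha> w" "w \<in> X" using alpha_surj beta_X by blast
      then have "v = \<beta> (\<alpha> w)" using beta_self_inverse[OF \<open>v \<in> X\<close>] by simp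
      then show "(z, x) \<in> dash ?D (qneg ?D S) O dash ?D (qneg ?D R)"
        using v E w x z dS dR
        by (auto simp: E_alpha1 E_alpha2 E_beta1 E_beta2 alpha_X beta_X intro!: relcompI)
    next
      assume "(z, x) \<in> dash ?D (qneg ?D S) O dash ?D (qneg ?D R)"
      then show "(\<beta> (\<alpha> x), \<beta> (\<alpha> z)) \<in> R O S" using dS dR by blast
    qed
    then show ?thesis using True x z
      by (auto simp: qplus_def neg_iff tilde_iff alpha_X E_alpha2 intro: E_sym)
  next
    case False
    then show ?thesis using z by (auto simp: qplus_def neg_iff tilde_iff E_alpha2 dest: E_sym)
  qed
  have "qneg ?D (R O S) \<subseteq> E" "qplus ?D (qneg ?D R) (qneg ?D S) \<subseteq> E"
    using tilde_sub by (auto simp: neg_iff qplus_def)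
  with * show ?thesis by (intro rel_eqI) auto
qed

theorem dqra_Dq: "dqra (Dq X leq E \<alpha> \<beta>)"
proof -
  have le_Up: "leq \<in> UpE leq E" using le_E le_trans by (intro UpE_I) blast+
  have l: "leq O R = R" if R: "R \<in> UpE leq E" for R
  proof
    show "leq O R \<subseteq> R" using up[OF R] le_refl Up_sub[OF R] E_X(2) by blast
    show "R \<subseteq> leq O R" using le_refl Up_sub[OF R] E_X(1) by fast
  qed
  have r: "R O leq = R" if R: "R \<in> UpE leq E" for R
  proof
    show "R O leq \<subseteq> R" using up[OF R] le_refl Up_sub[OF R] E_X(1) by blast
    show "R \<subseteq> R O leq" using le_refl Up_sub[OF R] E_X(2) by fast
  qed
  have "R \<inter> S \<in> UpE leq E" "R \<union> S \<in> UpE leq E" if "R \<in> UpE leq E" "S \<in> UpE leq E" for R S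
    using that unfolding UpE_def by blast+
  moreover have "qneg (Dq X leq E \<alpha> \<beta>) (R \<union> S) =
      qneg (Dq X leq E \<alpha> \<beta>) R \<inter> qneg (Dq X leq E \<alpha> \<beta>) S" for R S
    by (auto simp: neg_iff)
  ultimately show ?thesis
    using le_Up l r residuation1 residuation2
    by unfold_locales (auto simp: comp_Up tilde_Up dash_Up neg_Up O_assoc
      tilde_dash_Dq dash_tilde_Dq neg_neg_Dq neg_comp_Dq)
qed

end

end

theory Submission
  imports Defs
begin

text \<open>
  Under a representation of $\mathbf A$, the element $p$ becomes a relation $P$ that contains
  the order of the frame. Positivity and idempotence make $P$ a preorder; symmetry says exactly
  that \<open>\<alpha>\<close> preserves $P$ and that \<open>\<beta>\<close> reverses it. Hence \<open>\<alpha>\<close> and \<open>\<beta>\<close> descend to the poset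
  obtained by identifying points that are equivalent under $P$, and this gives a new frame. The
  elements of $p\mathbf Ap$ are represented by the relations $R$ with $P;R;P = R$, which are the
  ones that are determined by what they induce on this quotient. The quotient is taken as a set
  of representatives, so that it consists of points of the original type.
\<close>

section \<open>Homomorphisms and the carrier of the contraction\<close>

lemma qra_homD:
  assumes "h \<in> qra_hom A B"
  shows "a \<in> carrier A \<Longrightarrow> h a \<in> carrier B"
    and "h \<one>\<^bsub>A\<^esub> = \<one>\<^bsub>B\<^esub>"
    and "a \<in> carrier A \<Longrightarrow> b \<in> carrier A \<Longrightarrow> h (a \<otimes>\<^bsub>A\<^esub> b) = h a \<otimes>\<^bsub>B\<^esub> h b"
    and "a \<in> carrier A \<Longrightarrow> b \<in> carrier A \<Longrightarrow> h (a \<curlywedge>\<^bsub>A\<^esub> b) = h a \<curlywedge>\<^bsub>B\<^esub> h b"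
    and "a \<in> carrier A \<Longrightarrow> b \<in> carrier A \<Longrightarrow> h (a \<curlyvee>\<^bsub>A\<^esub> b) = h a \<curlyvee>\<^bsub>B\<^esub> h b"
    and "a \<in> carrier A \<Longrightarrow> h (tilde A a) = tilde B (h a)"
    and "a \<in> carrier A \<Longrightarrow> h (dash A a) = dash B (h a)"
    and "a \<in> carrier A \<Longrightarrow> h (qneg A a) = qneg B (h a)"
  using assms by (auto simp: qra_hom_def hom_def Pi_def)

lemma contraction_simps [simp]:
  "carrier (contraction A p) = {p \<otimes>\<^bsub>A\<^esub> a \<otimes>\<^bsub>A\<^esub> p | a. a \<in> carrier A}"
  "mult (contraction A p) = mult A"
  "one (contraction A p) = p"
  "qmeet (contraction A p) = qmeet A"
  "qjoin (contraction A p) = qjoin A"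
  "tilde (contraction A p) = tilde A"
  "dash (contraction A p) = dash A"
  "qneg (contraction A p) = qneg A"
  "qle (contraction A p) = qle A"
  "qplus (contraction A p) = qplus A"
  by (auto simp: contraction_def qle_def qplus_def fun_eq_iff)

text \<open>Idempotence lets the outer factors absorb another \<open>p\<close>. Membership thereby
  becomes two equations, which an injective homomorphism preserves and reflects.\<close>

lemma (in monoid) sandwich_iff:
  assumes "p \<in> carrier G" "p \<otimes> p = p"
  shows "a \<in> {p \<otimes> b \<otimes> p | b. b \<in> carrier G} \<longleftrightarrow> a \<in> carrier G \<and> p \<otimes> a = a \<and> a \<otimes> p = a"
proof
  assume "a \<in> {p \<otimes> b \<otimes> p | b. b \<in> carrier G}"
  then obtain b where b: "b \<in> carrier G" "a = p \<otimes> b \<otimes> p" by blast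
  have "p \<otimes> (p \<otimes> b \<otimes> p) = (p \<otimes> p) \<otimes> b \<otimes> p" "(p \<otimes> b \<otimes> p) \<otimes> p = p \<otimes> b \<otimes> (p \<otimes> p)"
    using assms(1) b(1) by (simp_all only: m_assoc m_closed)
  then show "a \<in> carrier G \<and> p \<otimes> a = a \<and> a \<otimes> p = a"
    using assms b by simp
qed (auto intro!: exI[of _ a])

section \<open>Frames with a symmetric preorder \<open>P\<close>, standing for the image of
  \<open>p\<close>\<close>

locale symmetric_preorder = dq_frame X leq E \<alpha> \<beta>
  for X :: "'x set" and leq E \<alpha> \<beta> +
  fixes P :: "'x rel"
  assumes P_sub: "P \<subseteq> E"
    and le_P: "leq \<subseteq> P"
    and P_trans: "(x, y) \<in> P \<Longrightarrow> (y, z) \<in> P \<Longrightarrow> (x, z) \<in> P"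
    and P_tilde_dash: "tilde (Dq X leq E \<alpha> \<beta>) P = dash (Dq X leq E \<alpha> \<beta>) P"
    and P_dash_neg: "dash (Dq X leq E \<alpha> \<beta>) P = qneg (Dq X leq E \<alpha> \<beta>) P"
begin

abbreviation "D \<equiv> Dq X leq E \<alpha> \<beta>"

lemma P_refl: "x \<in> X \<Longrightarrow> (x, x) \<in> P"
  using le_P le_refl by blast

lemma P_X: "(x, y) \<in> P \<Longrightarrow> x \<in> X" "(x, y) \<in> P \<Longrightarrow> y \<in> X"
  using P_sub E_X by blast+

lemma P_E: "(x, y) \<in> P \<Longrightarrow> (x, y) \<in> E"
  using P_sub by blast

text \<open>Inside \<open>E\<close>, the two sides of \<open>P_tilde_dash\<close> are evaluated at
  \<open>(y, \<alpha> x)\<close>: one says that \<open>(x, y)\<close> is not in \<open>P\<close>,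
  the other that \<open>(\<alpha> x, \<alpha> y)\<close> is not. Outside \<open>E\<close> neither
  pair can be in \<open>P\<close>.\<close>

lemma alpha_P:
  assumes "x \<in> X" "y \<in> X"
  shows "(\<alpha> x, \<alpha> y) \<in> P \<longleftrightarrow> (x, y) \<in> P"
proof (cases "(x, y) \<in> E")
  case True
  have "(y, \<alpha> x) \<in> tilde D P \<longleftrightarrow> (y, \<alpha> x) \<in> dash D P"
    by (simp add: P_tilde_dash)
  then show ?thesis
    using assms True by (simp add: tilde_iff dash_iff E_alpha1 E_alpha2)
next
  case False
  then show ?thesis
    using assms P_E[of x y] P_E[of "\<alpha> x" "\<alpha> y"] by (auto simp: E_alpha1 E_alpha2)
qed

text \<open>Writing \<open>x\<close> as \<open>\<alpha> x'\<close>, the two sides of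
  \<open>P_dash_neg\<close> at \<open>(x', y)\<close> exclude \<open>(y, x)\<close> and
  \<open>(\<beta> x, \<beta> y)\<close> from \<open>P\<close>, respectively.\<close>

lemma beta_P:
  assumes "x \<in> X" "y \<in> X"
  shows "(\<beta> x, \<beta> y) \<in> P \<longleftrightarrow> (y, x) \<in> P"
proof (cases "(x, y) \<in> E")
  case True
  obtain x' where x': "x' \<in> X" "x = \<alpha> x'"
    using assms(1) alpha_surj by blast
  have "(x', y) \<in> dash D P \<longleftrightarrow> (x', y) \<in> qneg D P"
    by (simp add: P_dash_neg)
  then show ?thesis
    using assms True x' E_sym[OF True] by (simp add: neg_iff dash_iff E_alpha1 E_alpha2)
next
  case False
  then show ?thesis
    using assms P_E[of y x] P_E[of "\<beta> x" "\<beta> y"] E_sym[of y x] by (auto simp: E_beta1 E_beta2)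
qed

section \<open>Relations that are up-sets with respect to \<open>P\<close>\<close>

lemma UpP_up: "R \<in> UpE P E \<Longrightarrow> (u, v) \<in> R \<Longrightarrow> (x, u) \<in> P \<Longrightarrow> (v, y) \<in> P \<Longrightarrow> (x, y) \<in> R"
proof -
  assume a: "R \<in> UpE P E" "(u, v) \<in> R" "(x, u) \<in> P" "(v, y) \<in> P"
  then have "(u, v) \<in> E" unfolding UpE_def by blast
  then have "(x, y) \<in> E" using P_E[OF a(3)] P_E[OF a(4)] by (meson E_trans)
  then show ?thesis using a unfolding UpE_def by blast
qed

lemma UpP_I: "R \<subseteq> E \<Longrightarrow> (\<And>u v x y. (u, v) \<in> R \<Longrightarrow> (x, u) \<in> P \<Longrightarrow> (v, y) \<in> P \<Longrightarrow> (x, y) \<in> R)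
    \<Longrightarrow> R \<in> UpE P E"
  unfolding UpE_def by blast

lemma UpP_E: "R \<in> UpE P E \<Longrightarrow> (x, y) \<in> R \<Longrightarrow> (x, y) \<in> E"
  unfolding UpE_def by blast

text \<open>This is the relational counterpart of \<open>sandwich_iff\<close>: reflexivity of
  \<open>P\<close> gives the inclusions of \<open>R\<close> in the products, and closure under
  \<open>P\<close> gives the reverse ones.\<close>

lemma UpP_iff: "R \<in> UpE P E \<longleftrightarrow> R \<in> UpE leq E \<and> P O R = R \<and> R O P = R"
proof
  assume R: "R \<in> UpE P E"
  have refl: "(x, x) \<in> P" "(y, y) \<in> P" if "(x, y) \<in> R" for x y
    using UpP_E[OF R that] E_X P_refl by blast+
  have "P O R \<subseteq> R" "R O P \<subseteq> R"
    using UpP_up[OF R _ _ refl(2)] UpP_up[OF R _ refl(1)] by (blast, blast)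
  moreover have "R \<subseteq> P O R" "R \<subseteq> R O P"
    using refl by auto
  moreover have "R \<in> UpE leq E"
    using R le_P unfolding UpE_def by blast
  ultimately show "R \<in> UpE leq E \<and> P O R = R \<and> R O P = R"
    by (simp add: subset_antisym)
next
  assume R: "R \<in> UpE leq E \<and> P O R = R \<and> R O P = R"
  show "R \<in> UpE P E"
  proof (rule UpP_I)
    show "R \<subseteq> E" using R unfolding UpE_def by blast
    show "(x, y) \<in> R" if "(u, v) \<in> R" "(x, u) \<in> P" "(v, y) \<in> P" for u v x y
      using R that by (metis relcompI)
  qed
qed

lemma UpP_inter: "R \<in> UpE P E \<Longrightarrow> S \<in> UpE P E \<Longrightarrow> R \<inter> S \<in> UpE P E"
  and UpP_union: "R \<in> UpE P E \<Longrightarrow> S \<in> UpE P E \<Longrightarrow> R \<union> S \<in> UpE P E"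
  unfolding UpE_def by blast+

text \<open>Since \<open>P\<close> need not be antisymmetric, \<open>tilde_Up\<close> cannot be
  instantiated with it. Its argument still works, because it rests on inclusion in \<open>E\<close>
  and on compatibility with \<alpha>, here \<open>alpha_P\<close>. The same holds for the next two
  lemmas, with \<open>beta_P\<close> added for \<open>qneg\<close>.\<close>

lemma tilde_UpP:
  assumes "R \<in> UpE P E"
  shows "tilde D R \<in> UpE P E"
proof (rule UpP_I[OF tilde_sub])
  fix u v x y
  assume a: "(u, v) \<in> tilde D R" "(x, u) \<in> P" "(v, y) \<in> P"
  obtain v' y' where v: "v = \<alpha> v'" "v' \<in> X" "y = \<alpha> y'" "y' \<in> X"
    using a(3) P_X alpha_surj by blast
  then have m: "(v', u) \<in> E - R" "(v', y') \<in> P"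
    using a by (auto simp: tilde_iff alpha_P)
  then have "(y', x) \<in> E"
    using E_trans[OF E_sym[OF P_E[OF m(2)]] E_trans[OF _ E_sym[OF P_E[OF a(2)]]]] by blast
  then have "(y', x) \<in> E - R"
    using m a(2) UpP_up[OF assms] by (auto dest: P_X)
  then show "(x, y) \<in> tilde D R" using v by (simp add: tilde_iff)
qed

lemma dash_UpP:
  assumes "R \<in> UpE P E"
  shows "dash D R \<in> UpE P E"
proof (rule UpP_I[OF dash_sub])
  fix u v x y
  assume a: "(u, v) \<in> dash D R" "(x, u) \<in> P" "(v, y) \<in> P"
  then have m: "(v, \<alpha> u) \<in> E - R" "(\<alpha> x, \<alpha> u) \<in> P"
    by (auto simp: dash_iff alpha_P P_X)
  then have "(y, \<alpha> x) \<in> E"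
    using E_trans[OF E_sym[OF P_E[OF a(3)]] E_trans[OF _ E_sym[OF P_E[OF m(2)]]]] by blast
  then have "(y, \<alpha> x) \<in> E - R"
    using m a(3) UpP_up[OF assms] by auto
  then show "(x, y) \<in> dash D R" using a(2) P_X by (auto simp: dash_iff)
qed

lemma neg_UpP:
  assumes "R \<in> UpE P E"
  shows "qneg D R \<in> UpE P E"
proof (rule UpP_I)
  show "qneg D R \<subseteq> E" by (auto simp: neg_iff)
  fix u v x y
  assume a: "(u, v) \<in> qneg D R" "(x, u) \<in> P" "(v, y) \<in> P"
  then have X: "u \<in> X" "v \<in> X" "x \<in> X" "y \<in> X" using P_X by auto
  have "(\<beta> (\<alpha> u), \<beta> (\<alpha> x)) \<in> P" "(\<beta> y, \<beta> v) \<in> P"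
    using a X by (auto simp: beta_P alpha_P alpha_X)
  then have "(\<beta> (\<alpha> x), \<beta> y) \<notin> R"
    using UpP_up[OF assms, of "\<beta> (\<alpha> x)" "\<beta> y" "\<beta> (\<alpha> u)" "\<beta> v"] a(1) by (auto simp: neg_iff)
  moreover have "(x, y) \<in> E" using a(1) E_trans[OF P_E[OF a(2)] E_trans[OF _ P_E[OF a(3)]]] by (simp add: neg_iff)
  ultimately show "(x, y) \<in> qneg D R" using X by (simp add: neg_iff)
qed

section \<open>Representatives of the classes of mutual \<open>P\<close>-comparability\<close>

definition rep :: "'x \<Rightarrow> 'x"
  where "rep x = (SOME y. (x, y) \<in> P \<and> (y, x) \<in> P)"

lemma rep_P: assumes "x \<in> X" shows "(x, rep x) \<in> P" "(rep x, x) \<in> P"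
  using someI[of "\<lambda>y. (x, y) \<in> P \<and> (y, x) \<in> P" x] P_refl[OF assms] by (auto simp: rep_def)

lemma rep_X: "x \<in> X \<Longrightarrow> rep x \<in> X"
  using rep_P P_X by blast

text \<open>The choice operator depends only on its predicate, and equivalent points have the same
  predicate by transitivity.\<close>

lemma rep_cong:
  assumes "(x, y) \<in> P" "(y, x) \<in> P"
  shows "rep x = rep y"
proof -
  have "(x, z) \<in> P \<and> (z, x) \<in> P \<longleftrightarrow> (y, z) \<in> P \<and> (z, y) \<in> P" for z
    using assms P_trans by blast
  then show ?thesis by (simp add: rep_def)
qed

lemma rep_rep: "x \<in> X \<Longrightarrow> rep (rep x) = rep x"
  using rep_cong rep_P by blast

lemma rep_alpha: "x \<in> X \<Longrightarrow> rep (\<alpha> (rep x)) = rep (\<alpha> x)"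
  by (intro rep_cong) (simp_all add: alpha_P rep_X rep_P)

lemma rep_beta: "x \<in> X \<Longrightarrow> rep (\<beta> (rep x)) = rep (\<beta> x)"
  by (intro rep_cong) (simp_all add: beta_P rep_X rep_P)

lemma UpP_rep1: "R \<in> UpE P E \<Longrightarrow> x \<in> X \<Longrightarrow> (rep x, y) \<in> R \<longleftrightarrow> (x, y) \<in> R"
  using UpP_up rep_P P_refl UpP_E E_X by metis

lemma UpP_rep2: "R \<in> UpE P E \<Longrightarrow> y \<in> X \<Longrightarrow> (x, rep y) \<in> R \<longleftrightarrow> (x, y) \<in> R"
  using UpP_up rep_P P_refl UpP_E E_X by metis

lemma P_UpP: "P \<in> UpE P E"
  using P_sub P_trans by (blast intro: UpP_I)

text \<open>With \<open>E\<close> itself an up-set for \<open>P\<close>, replacing points by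
  representatives is harmless in \<open>E\<close> just as in \<open>P\<close>.\<close>

lemma E_UpP: "E \<in> UpE P E"
  using P_E E_trans by (blast intro: UpP_I)

lemmas P_rep = UpP_rep1[OF P_UpP] UpP_rep2[OF P_UpP]
lemmas E_rep = UpP_rep1[OF E_UpP] UpP_rep2[OF E_UpP]

section \<open>The quotient frame on representatives\<close>

definition Xq :: "'x set" where "Xq = rep ` X"

lemma rep_Xq: "x \<in> X \<Longrightarrow> rep x \<in> Xq"
  by (simp add: Xq_def)

text \<open>For members of \<open>UpE P E\<close> this is a concrete form of the relation induced on
  the quotient, since they do not distinguish equivalent points.\<close>

definition restr :: "'x rel \<Rightarrow> 'x rel"
  where "restr R = R \<inter> Xq \<times> Xq"

lemma restr_iff: "(x, y) \<in> restr R \<longleftrightarrow> (x, y) \<in> R \<and> x \<in> Xq \<and> y \<in> Xq"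
  by (auto simp: restr_def)

lemma XqD: "x \<in> Xq \<Longrightarrow> x \<in> X" "x \<in> Xq \<Longrightarrow> rep x = x"
  using rep_X rep_rep by (auto simp: Xq_def)

definition alphaq :: "'x \<Rightarrow> 'x" where "alphaq x = rep (\<alpha> x)"
definition betaq :: "'x \<Rightarrow> 'x" where "betaq x = rep (\<beta> x)"

lemma alphaq_Xq: "x \<in> Xq \<Longrightarrow> alphaq x \<in> Xq"
  and betaq_Xq: "x \<in> Xq \<Longrightarrow> betaq x \<in> Xq"
  by (simp_all add: alphaq_def betaq_def rep_Xq alpha_X beta_X XqD(1))

lemma betaq_betaq: "x \<in> Xq \<Longrightarrow> betaq (betaq x) = x"
  using XqD[of x] by (simp add: betaq_def rep_beta beta_X beta_self_inverse)

lemma alphaq_betaq_alphaq: "x \<in> Xq \<Longrightarrow> alphaq (betaq (alphaq x)) = betaq x"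
  using XqD[of x] by (simp add: betaq_def alphaq_def rep_beta rep_alpha beta_X alpha_X aba)

lemma alphaq_P: "x \<in> Xq \<Longrightarrow> y \<in> Xq \<Longrightarrow> (alphaq x, alphaq y) \<in> P \<longleftrightarrow> (x, y) \<in> P"
  and betaq_P: "x \<in> Xq \<Longrightarrow> y \<in> Xq \<Longrightarrow> (betaq x, betaq y) \<in> P \<longleftrightarrow> (y, x) \<in> P"
  using XqD[of x] XqD[of y]
  by (simp_all add: alphaq_def betaq_def P_rep rep_X alpha_X beta_X alpha_P beta_P)

text \<open>Each class has a single representative, so the preorder \<open>P\<close> becomes a
  partial order here.\<close>

lemma Xq_antisym: "x \<in> Xq \<Longrightarrow> y \<in> Xq \<Longrightarrow> (x, y) \<in> P \<Longrightarrow> (y, x) \<in> P \<Longrightarrow> x = y"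
  using rep_cong XqD(2) by metis

lemma alphaq_bij: "bij_betw alphaq Xq Xq"
  unfolding bij_betw_def
proof
  show "inj_on alphaq Xq"
  proof (rule inj_onI)
    fix x y
    assume a: "x \<in> Xq" "y \<in> Xq" "alphaq x = alphaq y"
    \<comment> \<open>Reflexivity at the common image is pulled back along \<open>alphaq_P\<close>
      in both directions, so that antisymmetry applies.\<close>
    have "(alphaq x, alphaq x) \<in> P"
      using alphaq_Xq[OF a(1)] XqD P_refl by blast
    then have "(x, y) \<in> P" "(y, x) \<in> P"
      using a alphaq_P by metis+
    then show "x = y" using a Xq_antisym by blast
  qed
  show "alphaq ` Xq = Xq"
  proof
    show "alphaq ` Xq \<subseteq> Xq" using alphaq_Xq by blast
    show "Xq \<subseteq> alphaq ` Xq"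
    proof
      fix y
      assume y: "y \<in> Xq"
      then obtain z where z: "z \<in> X" "y = \<alpha> z" using XqD(1) alpha_surj by blast
      \<comment> \<open>The preimage \<open>z\<close> under \<alpha> need not be a representative,
        so \<open>rep z\<close> serves as the witness.\<close>
      then have "alphaq (rep z) = y" using XqD(2)[OF y] by (simp add: alphaq_def rep_alpha)
      then show "y \<in> alphaq ` Xq" using z(1) rep_Xq by blast
    qed
  qed
qed

lemma quotient_frame: "dq_frame Xq (restr P) (restr E) alphaq betaq"
proof
  show "partial_order_on Xq (restr P)"
    unfolding partial_order_on_def preorder_on_def
  proof (intro conjI)
    show "restr P \<subseteq> Xq \<times> Xq" by (auto simp: restr_def)
    show "refl_on Xq (restr P)"
      by (rule refl_onI) (simp add: restr_iff P_refl XqD(1))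
    show "trans (restr P)"
      by (rule transI) (metis restr_iff P_trans)
    show "antisym (restr P)"
      by (rule antisymI) (metis restr_iff Xq_antisym)
  qed
  show "equiv Xq (restr E)"
  proof (rule equivI)
    show "restr E \<subseteq> Xq \<times> Xq" by (auto simp: restr_def)
    show "refl_on Xq (restr E)"
      by (rule refl_onI) (simp add: restr_iff E_refl XqD(1))
    show "sym (restr E)"
      by (rule symI) (metis restr_iff E_sym)
    show "trans (restr E)"
      by (rule transI) (metis restr_iff E_trans)
  qed
  show "restr P \<subseteq> restr E"
    using P_E by (auto simp: restr_def)
  show "order_automorphism Xq (restr P) alphaq"
    unfolding order_automorphism_def
    by (simp add: alphaq_bij restr_iff alphaq_P alphaq_Xq)
  have "bij_betw betaq Xq Xq"
    by (rule bij_betw_byWitness[of _ betaq]) (use betaq_betaq betaq_Xq in blast)+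
  then show "dual_order_automorphism Xq (restr P) betaq"
    unfolding dual_order_automorphism_def
    by (simp add: restr_iff betaq_P betaq_Xq)
  show "betaq (betaq x) = x" if "x \<in> Xq" for x
    using that by (rule betaq_betaq)
  show "graph_on Xq alphaq \<subseteq> restr E"
    by (auto simp: graph_on_def restr_iff alphaq_Xq) (simp add: alphaq_def E_rep alpha_X alpha_rel XqD(1))
  show "graph_on Xq betaq \<subseteq> restr E"
    by (auto simp: graph_on_def restr_iff betaq_Xq) (simp add: betaq_def E_rep beta_X beta_rel XqD(1))
  have "graph_on Xq alphaq O graph_on Xq betaq O graph_on Xq alphaq
      = {(x, alphaq (betaq (alphaq x))) | x. x \<in> Xq}"
    using alphaq_Xq betaq_Xq unfolding graph_on_def by blast
  also have "\<dots> = graph_on Xq betaq"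
    using alphaq_betaq_alphaq unfolding graph_on_def by metis
  finally show "graph_on Xq alphaq O graph_on Xq betaq O graph_on Xq alphaq = graph_on Xq betaq" .
qed

sublocale Q: dq_frame Xq "restr P" "restr E" alphaq betaq
  by (rule quotient_frame)

section \<open>Restriction to representatives as an injective homomorphism\<close>

abbreviation "DQ \<equiv> Dq Xq (restr P) (restr E) alphaq betaq"

lemma restr_Up: "R \<in> UpE P E \<Longrightarrow> restr R \<in> UpE (restr P) (restr E)"
  by (rule Q.UpE_I) (auto simp: restr_iff intro: UpP_E UpP_up)

lemma restr_Int: "restr (R \<inter> S) = restr R \<inter> restr S"
  and restr_Un: "restr (R \<union> S) = restr R \<union> restr S"
  by (auto simp: restr_def)

text \<open>An intermediate point may lie outside \<open>Xq\<close>; membership in both factors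
  survives replacing it by its representative.\<close>

lemma restr_comp:
  assumes "R \<in> UpE P E" "S \<in> UpE P E"
  shows "restr (R O S) = restr R O restr S"
proof
  show "restr (R O S) \<subseteq> restr R O restr S"
  proof clarify
    fix x y
    assume "(x, y) \<in> restr (R O S)"
    then obtain z where z: "(x, z) \<in> R" "(z, y) \<in> S" "x \<in> Xq" "y \<in> Xq"
      by (auto simp: restr_iff)
    then have "z \<in> X" using UpP_E[OF assms(1)] E_X by blast
    then have "(x, rep z) \<in> restr R" "(rep z, y) \<in> restr S"
      using z assms by (simp_all add: restr_iff UpP_rep1 UpP_rep2 rep_Xq)
    then show "(x, y) \<in> restr R O restr S" by blast
  qed
  show "restr R O restr S \<subseteq> restr (R O S)" by (auto simp: restr_def)
qed

text \<open>By surjectivity of \<open>alphaq\<close> it suffices to test pairs ending in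
  \<open>alphaq z\<close>. There \<open>\<alpha> z\<close> may be used instead, because
  \<open>tilde D R\<close> is again an up-set for \<open>P\<close>.\<close>

lemma restr_tilde:
  assumes "R \<in> UpE P E"
  shows "restr (tilde D R) = tilde DQ (restr R)"
proof (rule Q.rel_eqI)
  show "restr (tilde D R) \<subseteq> restr E" using tilde_sub by (auto simp: restr_def)
  show "tilde DQ (restr R) \<subseteq> restr E" by (rule Q.tilde_sub)
  fix x z
  assume z: "z \<in> Xq"
  have "(x, alphaq z) \<in> tilde D R \<longleftrightarrow> (x, \<alpha> z) \<in> tilde D R"
    using tilde_UpP[OF assms] XqD(1)[OF z] by (simp add: alphaq_def UpP_rep2 alpha_X)
  then show "(x, alphaq z) \<in> restr (tilde D R) \<longleftrightarrow> (x, alphaq z) \<in> tilde DQ (restr R)"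
    using z XqD(1)[OF z] alphaq_Xq[OF z] by (auto simp only: Q.tilde_iff tilde_iff restr_iff)
qed

lemma restr_dash:
  assumes "R \<in> UpE P E"
  shows "restr (dash D R) = dash DQ (restr R)"
proof (rule rel_ext)
  fix x y
  have "(y, alphaq x) \<in> R \<longleftrightarrow> (y, \<alpha> x) \<in> R" "(y, alphaq x) \<in> E \<longleftrightarrow> (y, \<alpha> x) \<in> E" if "x \<in> Xq"
    using assms XqD(1)[OF that] by (simp_all add: alphaq_def UpP_rep2 E_rep alpha_X)
  then show "(x, y) \<in> restr (dash D R) \<longleftrightarrow> (x, y) \<in> dash DQ (restr R)"
    using XqD(1)[of x] alphaq_Xq[of x] by (auto simp only: Q.dash_iff dash_iff restr_iff)
qed

text \<open>The pair tested by the quotient negation differs from the original one only by passing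
  to representatives, which \<open>R\<close> cannot detect.\<close>

lemma restr_neg:
  assumes "R \<in> UpE P E"
  shows "restr (qneg D R) = qneg DQ (restr R)"
proof (rule rel_ext)
  fix x y
  have "(betaq (alphaq x), betaq y) \<in> R \<longleftrightarrow> (\<beta> (\<alpha> x), \<beta> y) \<in> R" if "x \<in> Xq" "y \<in> Xq"
    using assms XqD(1)[OF that(1)] XqD(1)[OF that(2)]
    by (simp add: alphaq_def betaq_def UpP_rep1 UpP_rep2 rep_beta alpha_X beta_X)
  then show "(x, y) \<in> restr (qneg D R) \<longleftrightarrow> (x, y) \<in> qneg DQ (restr R)"
    using XqD(1)[of x] XqD(1)[of y] alphaq_Xq[of x] betaq_Xq[of y] betaq_Xq[of "alphaq x"]
    by (auto simp only: Q.neg_iff neg_iff restr_iff)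
qed

text \<open>A relation in \<open>UpE P E\<close> is recovered from its restriction as the preimage
  under \<open>rep\<close> in both coordinates.\<close>

lemma restr_inj: "inj_on restr (UpE P E)"
proof (rule inj_onI)
  have *: "R = {(x, y). x \<in> X \<and> y \<in> X \<and> (rep x, rep y) \<in> restr R}" if "R \<in> UpE P E" for R
  proof (rule rel_ext)
    fix x y
    have "(x, y) \<in> R \<Longrightarrow> x \<in> X \<and> y \<in> X" using UpP_E[OF that] E_X by blast
    then show "(x, y) \<in> R \<longleftrightarrow> (x, y) \<in> {(x, y). x \<in> X \<and> y \<in> X \<and> (rep x, rep y) \<in> restr R}"
      using that by (auto simp: restr_iff UpP_rep1 UpP_rep2 rep_X rep_Xq)
  qed
  fix R S
  assume "R \<in> UpE P E" "S \<in> UpE P E" "restr R = restr S"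
  then show "R = S" using *[of R] *[of S] by simp
qed

section \<open>Embedding the contraction into the algebra of the quotient frame\<close>

lemma contraction_embedding:
  assumes "dqra A" and h: "h \<in> qra_hom A D" and inj: "inj_on h (carrier A)"
    and p: "p \<in> carrier A" "idempotent_elem A p" and hp: "h p = P"
  shows "dqra (contraction A p)" and "embeds (contraction A p) DQ"
proof -
  interpret A: dqra A by fact
  note h_simps = qra_homD[OF h]
  \<comment> \<open>Injectivity of \<open>h\<close> translates the fixed-point equations of
    \<open>sandwich_iff\<close> into those of \<open>UpP_iff\<close>. Closure of the contraction can
    then be checked on relations.\<close>
  have C: "a \<in> carrier (contraction A p) \<longleftrightarrow> a \<in> carrier A \<and> h a \<in> UpE P E" for a
  proof -
    have "p \<otimes>\<^bsub>A\<^esub> a = a \<longleftrightarrow> P O h a = h a" "a \<otimes>\<^bsub>A\<^esub> p = a \<longleftrightarrow> h a O P = h a" if "a \<in> carrier A"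
      using inj_on_eq_iff[OF inj, of "p \<otimes>\<^bsub>A\<^esub> a" a] inj_on_eq_iff[OF inj, of "a \<otimes>\<^bsub>A\<^esub> p" a] that p
      by (simp_all add: h_simps hp)
    moreover have "h a \<in> UpE leq E" if "a \<in> carrier A"
      using h_simps(1)[OF that] by simp
    ultimately show ?thesis
      using p A.sandwich_iff[of p a] UpP_iff[of "h a"] by (auto simp: idempotent_elem_def)
  qed
  have C_mult: "a \<otimes>\<^bsub>A\<^esub> b \<in> carrier (contraction A p)"
    if "a \<in> carrier (contraction A p)" "b \<in> carrier (contraction A p)" for a b
  proof -
    have ab: "h a \<in> UpE P E" "h b \<in> UpE P E" using that C by blast+
    then have "h a O h b \<in> UpE P E"
      using UpP_iff[of "h a"] UpP_iff[of "h b"] UpP_iff[of "h a O h b"]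
      by (metis O_assoc comp_Up)
    then show ?thesis using that unfolding C by (simp add: h_simps)
  qed
  have C_unit: "p \<otimes>\<^bsub>A\<^esub> a = a \<and> a \<otimes>\<^bsub>A\<^esub> p = a" if "a \<in> carrier (contraction A p)" for a
    using that p A.sandwich_iff[of p a] by (simp add: idempotent_elem_def)
  note cl = UpP_inter UpP_union tilde_UpP dash_UpP neg_UpP
  have CA: "a \<in> carrier A" if "a \<in> carrier (contraction A p)" for a
    using that unfolding C by blast
  show "dqra (contraction A p)"
  \<comment> \<open>Closure comes from the up-sets for \<open>P\<close>, the unit law from
    absorption of \<open>p\<close>, and the remaining laws from \<open>A\<close>. The carrier
    equation is removed from the simplifier so that \<open>C\<close> can describe membership
    instead.\<close>
  proof (unfold_locales, goal_cases)
    case (1 x y)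
    then show ?case using C_mult by (simp del: contraction_simps(1))
  next
    case (2 x y z)
    then show ?case using CA by (simp del: contraction_simps(1) add: A.m_assoc)
  next
    case 3
    then show ?case using p P_UpP hp by (simp del: contraction_simps(1) add: C)
  next
    case (4 x)
    then show ?case using C_unit by (simp del: contraction_simps(1))
  next
    case (5 x)
    then show ?case using C_unit by (simp del: contraction_simps(1))
  qed (simp_all del: contraction_simps(1) add: C h_simps cl A.meet_closed A.join_closed
      A.tilde_closed A.dash_closed A.neg_closed A.meet_assoc A.join_assoc A.meet_absorb
      A.join_absorb A.tilde_dash A.dash_tilde A.neg_neg A.neg_join A.neg_mult
      A.meet_join_distrib A.residuation_dash[symmetric] A.residuation_tilde[symmetric],
      auto intro: A.meet_comm A.join_comm)
  \<comment> \<open>The identity \<open>p\<close> goes to \<open>P\<close> under \<open>h\<close>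
    and then to \<open>restr P\<close>, the order of the quotient frame.\<close>
  have "restr \<circ> h \<in> qra_hom (contraction A p) DQ"
    unfolding qra_hom_def hom_def
    by (simp del: contraction_simps(1) add: Pi_def C h_simps hp restr_Up restr_Int restr_Un
        restr_comp restr_tilde restr_dash restr_neg)
  moreover have "inj_on (restr \<circ> h) (carrier (contraction A p))"
    using inj restr_inj C by (auto simp only: inj_on_def comp_apply)
  ultimately show "embeds (contraction A p) DQ"
    unfolding embeds_def by blast
qed

end

text \<open>Both notions of representability follow from one construction: the new points form the
  image of \<open>X\<close> under \<open>rep\<close>, so finiteness is inherited.\<close>

lemma contraction_embeds_smaller_frame:
  fixes X :: "'x set" and A :: "'a qra"
  assumes p: "p \<in> carrier A" "positive_elem A p" "symmetric_elem A p" "idempotent_elem A p"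
    and A: "dqra A" and frame: "dq_frame X leq E \<alpha> \<beta>" and emb: "embeds A (Dq X leq E \<alpha> \<beta>)"
  shows "dqra (contraction A p) \<and> (\<exists>Y leq' E' \<alpha>' \<beta>'. (finite X \<longrightarrow> finite (Y :: 'x set)) \<and>
    dq_frame Y leq' E' \<alpha>' \<beta>' \<and> embeds (contraction A p) (Dq Y leq' E' \<alpha>' \<beta>'))"
proof -
  interpret A: dqra A by fact
  interpret dq_frame X leq E \<alpha> \<beta> by fact
  obtain h where h: "h \<in> qra_hom A (Dq X leq E \<alpha> \<beta>)" and inj: "inj_on h (carrier A)"
    using emb unfolding embeds_def by blast
  note h_simps = qra_homD[OF h]
  interpret symmetric_preorder X leq E \<alpha> \<beta> "h p"
  proof
    show "h p \<subseteq> E"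
      using h_simps(1)[OF p(1)] Up_sub by auto
    \<comment> \<open>Under \<open>h\<close>, this meet equation for positivity says that
      \<open>leq\<close> equals its intersection with \<open>h p\<close>.\<close>
    have "h (\<one>\<^bsub>A\<^esub> \<curlywedge>\<^bsub>A\<^esub> p) = h \<one>\<^bsub>A\<^esub>"
      using p(2) by (simp add: positive_elem_def qle_def)
    then show "leq \<subseteq> h p"
      using p(1) by (simp add: h_simps) blast
    have "h (p \<otimes>\<^bsub>A\<^esub> p) = h p"
      using p(4) by (simp add: idempotent_elem_def)
    then have "h p O h p = h p"
      using p(1) by (simp add: h_simps)
    then show "(x, z) \<in> h p" if "(x, y) \<in> h p" "(y, z) \<in> h p" for x y z
      using that by blast
    \<comment> \<open>The relational operations are pulled back inside \<open>h\<close>, where the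
      symmetry of \<open>p\<close> equates the arguments.\<close>
    show "tilde (Dq X leq E \<alpha> \<beta>) (h p) = dash (Dq X leq E \<alpha> \<beta>) (h p)"
      "dash (Dq X leq E \<alpha> \<beta>) (h p) = qneg (Dq X leq E \<alpha> \<beta>) (h p)"
      using p(1,3) by (simp_all add: symmetric_elem_def flip: h_simps(6-8))
  qed
  show ?thesis
    using contraction_embedding[OF A h inj p(1,4) refl] quotient_frame finite_imageI[of X rep]
    unfolding Xq_def by blast
qed

theorem theorem4:
  fixes A :: "'a qra" and p :: 'a
  assumes "p \<in> carrier A" and "positive_elem A p" and "symmetric_elem A p" and "idempotent_elem A p"
  shows "(representable TYPE('x) A \<longrightarrow> representable TYPE('x) (contraction A p)) \<and>
    (finitely_representable TYPE('x) A \<longrightarrow> finitely_representable TYPE('x) (contraction A p))"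
  unfolding representable_def finitely_representable_def
  using contraction_embeds_smaller_frame[OF assms] by blast

end
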